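(* If $\chi(H)\le 2$, then $t(n,H)=O\left(n^{2-1/2^{s(H)-1}}\right)$. In particular, if $s(H)=1$, then $t(n,H)=O(n)$.
   Context: $H$ is a fixed tournament and $n\to\infty$. A tournament is a digraph having exactly one of the edges $(u,v),(v,u)$ for every pair of distinct vertices $u,v$. A set of vertices of a tournament is transitive if the sub-tournament it induces has no directed cycle. For a positive integer $k$, a $k$-coloring of a tournament is a partition of its vertex set into $k$ parts (color classes), each of which induces a transitive sub-tournament. The chromatic number $\chi(H)$ is the minimum $k$ such that $H$ admits a $k$-coloring. For a 2-chromatic tournament $H$, $s(H)$ denotes the smallest integer $s$ such that there is a 2-coloring of $H$ with a color class of size $s$. Adding an edge to a tournament means adding the reverse $(v,u)$ of some existing edge $(u,v)$. A digraph contains a copy of $H$ if it has a (not necessarily induced) subgraph isomorphic to $H$. For $n\ge |V(H)|$, $t(n,H)$ is the smallest integer $t$ such that adding any $t$ edges to any $n$-vertex tournament results in a digraph containing a copy of $H$. *)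

theory Defs
  imports
    "Graph_Theory.Graph_Theory"
    "HOL-Library.Disjoint_Sets"
    "HOL-Library.Landau_Symbols"
begin

text \<open>The locale \<open>pair_digraph\<close> provides finiteness and the absence of loops; parallel edges are
  excluded by the representation, whereas antiparallel edges are not.\<close>

locale tournament = pair_digraph T for T :: "'a pair_pre_digraph" +
  assumes exactly_one: "\<lbrakk>u \<in> pverts T; v \<in> pverts T; u \<noteq> v\<rbrakk>
    \<Longrightarrow> ((u, v) \<in> parcs T) \<noteq> ((v, u) \<in> parcs T)"

definition transitive_set :: "'a pair_pre_digraph \<Rightarrow> 'a set \<Rightarrow> bool" where
  "transitive_set T S \<longleftrightarrow>
     S \<subseteq> pverts T \<and> (\<nexists>p. pre_digraph.cycle (with_proj T \<restriction> S) p)"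

text \<open>Colour classes are indexed by \<open>i < k\<close> and may be empty, so that a \<open>k\<close>-colouring exists for
  every \<open>k\<close> that is at least the chromatic number. The values \<open>C i\<close> with \<open>i \<ge> k\<close> are irrelevant.\<close>

definition coloring :: "'a pair_pre_digraph \<Rightarrow> nat \<Rightarrow> (nat \<Rightarrow> 'a set) \<Rightarrow> bool" where
  "coloring T k C \<longleftrightarrow>
     disjoint_family_on C {..<k} \<and> (\<Union>i<k. C i) = pverts T \<and> (\<forall>i<k. transitive_set T (C i))"

definition chromatic_number :: "'a pair_pre_digraph \<Rightarrow> nat" where
  "chromatic_number T = (LEAST k. 0 < k \<and> (\<exists>C. coloring T k C))"

text \<open>This is defined whenever the chromatic number is at most 2. Both classes of a 2-colouring are
  nonempty if the chromatic number is exactly 2; the value is 0 if the tournament is transitive.\<close>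

definition min_class_size :: "'a pair_pre_digraph \<Rightarrow> nat" where
  "min_class_size T = (LEAST s. \<exists>C. coloring T 2 C \<and> (\<exists>i<2. card (C i) = s))"

definition add_reversed :: "'a pair_pre_digraph \<Rightarrow> ('a \<times> 'a) set \<Rightarrow> 'a pair_pre_digraph" where
  "add_reversed T F = T\<lparr>parcs := parcs T \<union> F\<inverse>\<rparr>"

definition contains_copy :: "'a pair_pre_digraph \<Rightarrow> 'b pair_pre_digraph \<Rightarrow> bool" where
  "contains_copy D H \<longleftrightarrow> (\<exists>K. subgraph K (with_proj D) \<and> digraph_iso K (with_proj H))"

text \<open>Every finite tournament has an isomorphic copy with vertices in \<open>nat\<close>. For
  \<open>n \<ge> card (pverts H)\<close>, adding all \<open>n choose 2\<close> reverse edges yields a copy of \<open>H\<close>, so the minimum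
  exists and is attained at some \<open>t \<le> n choose 2\<close>; the function is only meaningful for such \<open>n\<close>.\<close>

definition turan_add :: "nat \<Rightarrow> 'b pair_pre_digraph \<Rightarrow> nat" where
  "turan_add n H = (LEAST t. \<forall>(T :: nat pair_pre_digraph) F.
     tournament T \<and> card (pverts T) = n \<and> F \<subseteq> parcs T \<and> card F = t
       \<longrightarrow> contains_copy (add_reversed T F) H)"

end

theory Submission
  imports Defs
begin

text \<open>
  Let \<open>F\<close> be the set of edges whose reverses are added. Every pair in \<open>F\<close> is then joined in both
  directions, so if \<open>F\<close> contains all pairs between two disjoint vertex sets \<open>R\<close> and \<open>S\<close>, the cross
  edges put no constraint on a copy of \<open>H\<close> that splits along \<open>R\<close> and \<open>S\<close>. If \<open>H\<close> is 2-coloured with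
  classes of sizes \<open>s\<close> and \<open>b\<close>, it therefore suffices that \<open>R\<close> contains a transitive set of size \<open>s\<close>
  and \<open>S\<close> one of size \<open>b\<close>: two transitive tournaments of the same size are isomorphic. A tournament
  on \<open>2 ^ (k - 1)\<close> vertices has a transitive set of size \<open>k\<close>, so what is needed is a complete
  bipartite graph with sides \<open>r = 2 ^ (s - 1)\<close> and \<open>q = 2 ^ (b - 1)\<close> inside \<open>F\<close>.

  This is the theorem of Kovari, Sos and Turan, \<open>common_neighbours_of_some_subset\<close>: the double
  count of pairs of a vertex and an \<open>r\<close>-subset of its neighbourhood shows that a graph on \<open>n\<close>
  vertices with at least \<open>C n\<^bsup>2 - 1/r\<^esup>\<close> edges, where \<open>C\<close> depends on \<open>r\<close> and \<open>q\<close>, has \<open>r\<close>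
  vertices with \<open>q\<close> common neighbours. It is applied to the out-neighbourhoods with respect to \<open>F\<close>,
  which contain only some of the neighbours but already have \<open>card F\<close> as the sum of their sizes.
  With \<open>r = 2 ^ (s - 1)\<close> the exponent is the stated one.

  If \<open>s = 0\<close>, that is, if \<open>H\<close> itself is transitive, every large tournament contains \<open>H\<close> and
  \<open>turan_add n H\<close> is eventually \<open>0\<close>.

  Transitive sets are handled as lists sorted with respect to the edge relation; an isomorphism of
  two of them then matches equal positions.
\<close>

section \<open>Common neighbours in dense graphs\<close>

text \<open>The power mean inequality, with the mean \<open>a\<close> given. The function \<open>y ^ r\<close> lies above its tangent
  at \<open>a\<close> by Bernoulli's inequality, and the linear terms of the tangents cancel in the sum.\<close>

lemma sum_power_ge_power_mean:
  fixes x :: "'b \<Rightarrow> real" and a :: real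
  assumes nonneg: "\<And>v. v \<in> V \<Longrightarrow> 0 \<le> x v"
    and a: "0 < a" "sum x V = card V * a"
  shows "card V * a ^ r \<le> (\<Sum>v\<in>V. x v ^ r)"
proof -
  have "a ^ r * (1 + r * (x v / a - 1)) \<le> x v ^ r" if "v \<in> V" for v
  proof -
    have "1 + r * (x v / a - 1) \<le> (1 + (x v / a - 1)) ^ r"
      using nonneg[OF that] a(1) by (intro Bernoulli_inequality) auto
    also have "\<dots> = x v ^ r / a ^ r" by (simp add: power_divide)
    finally show ?thesis using a(1) by (simp add: field_simps)
  qed
  then have "(\<Sum>v\<in>V. a ^ r * (1 + r * (x v / a - 1))) \<le> (\<Sum>v\<in>V. x v ^ r)"
    by (intro sum_mono)
  moreover have "(\<Sum>v\<in>V. a ^ r * (1 + r * (x v / a - 1))) = card V * a ^ r"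
  proof -
    have "(\<Sum>v\<in>V. x v / a - 1) = 0"
      using a by (simp add: sum_subtractf flip: sum_divide_distrib)
    then show ?thesis
      by (simp add: sum.distrib flip: sum_distrib_left)
  qed
  ultimately show ?thesis by simp
qed

text \<open>Subtracting 1 makes the usual lower bound on binomial coefficients valid also for \<open>d < r\<close>, so
  that vertices of small degree need no separate treatment in the double count.\<close>

lemma power_div_le_binomial_plus_one:
  assumes "0 < r"
  shows "(real d / real r) ^ r - 1 \<le> real (d choose r)"
proof (cases "r \<le> d")
  case True
  then have "(real d / real r) ^ r \<le> real (d choose r)"
    by (rule binomial_ge_n_over_k_pow_k)
  then show ?thesis by simp
next
  case False
  then have "(real d / real r) ^ r \<le> 1"
    using assms by (intro power_le_one) auto
  then show ?thesis using False by simp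
qed

text \<open>If every \<open>r\<close>-set \<open>R\<close> lay in fewer than \<open>q\<close> neighbourhoods, there would be at most
  \<open>q n\<^sup>r\<close> pairs \<open>(v, R)\<close> with \<open>R \<subseteq> N v\<close>. On the other hand there are at least
  \<open>n (d / r)\<^sup>r - n\<close> such pairs, where \<open>d\<close> is the average degree. The density makes \<open>d / r\<close> at least
  \<open>(q + 2) n\<^bsup>1 - 1/r\<^esup>\<close>, so that the lower bound is at least \<open>(q + 2) n\<^sup>r - n \<ge> (q + 1) n\<^sup>r\<close>.\<close>

lemma common_neighbours_of_some_subset:
  fixes N :: "'b \<Rightarrow> 'b set"
  assumes fin: "finite V" and sub: "\<And>v. v \<in> V \<Longrightarrow> N v \<subseteq> V" and n: "0 < card V" and r: "0 < r"
    and dense: "real (r * (q + 2)) * real (card V) powr (2 - 1 / real r) \<le> real (\<Sum>v\<in>V. card (N v))"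
  shows "\<exists>R\<subseteq>V. card R = r \<and> q \<le> card {v \<in> V. R \<subseteq> N v}"
proof (rule ccontr)
  assume neg: "\<not> ?thesis"
  define n where "n = card V"
  define P where "P = {R. R \<subseteq> V \<and> card R = r}"
  \<comment> \<open>the average degree, scaled by \<open>r\<close> as in the lower bound for the binomial coefficients\<close>
  define a where "a = real (\<Sum>v\<in>V. card (N v)) / (n * r)"
  have n_pos: "0 < n" using n by (simp add: n_def)
  have finP: "finite P" using fin by (simp add: P_def)
  have choose: "card {R \<in> P. R \<subseteq> N v} = card (N v) choose r" if "v \<in> V" for v
  proof -
    have "{R \<in> P. R \<subseteq> N v} = {R. R \<subseteq> N v \<and> card R = r}"
      using sub[OF that] by (auto simp: P_def)
    then show ?thesis
      using finite_subset[OF sub[OF that] fin] by (simp add: n_subsets)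
  qed
  let ?p = "real n powr (1 - 1 / real r)"
  have "real n powr (2 - 1 / real r) = real n * ?p"
    using n_pos powr_add[of "real n" 1 "1 - 1 / real r"] by simp
  then have a_ge: "real (q + 2) * ?p \<le> a"
    using dense n_pos r by (simp add: a_def n_def[symmetric] pos_le_divide_eq algebra_simps)
  moreover have "0 < real (q + 2) * ?p" using n_pos by simp
  ultimately have a_pos: "0 < a" by linarith
  have n_p: "real n * ?p ^ r = real n ^ r"
  proof -
    have "?p ^ r = real n powr (real r - 1)"
      using n_pos r by (simp add: powr_powr left_diff_distrib flip: powr_realpow)
    moreover have "real n * real n powr (real r - 1) = real n powr real r"
      using n_pos powr_add[of "real n" 1 "real r - 1"] by simp
    ultimately show ?thesis using n_pos by (simp add: powr_realpow)
  qed
  have "real (q + 2) \<le> real (q + 2) ^ r"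
    using r by (intro self_le_power) auto
  then have "real (q + 2) * real n ^ r \<le> real (q + 2) ^ r * real n ^ r"
    by (rule mult_right_mono) simp
  also have "\<dots> = real n * (real (q + 2) * ?p) ^ r"
    unfolding n_p[symmetric] power_mult_distrib by (simp only: mult_ac)
  also have "\<dots> \<le> real n * a ^ r"
    using a_ge by (intro mult_left_mono power_mono) auto
  finally have low: "real (q + 2) * real n ^ r \<le> real n * a ^ r" .
  have "n * a ^ r - n \<le> (\<Sum>v\<in>V. (card (N v) / r) ^ r) - n"
    using sum_power_ge_power_mean[of V "\<lambda>v. real (card (N v)) / real r" a r] a_pos n_pos r
    by (simp add: n_def[symmetric] a_def flip: sum_divide_distrib)
  also have "\<dots> = (\<Sum>v\<in>V. (card (N v) / r) ^ r - 1)"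
    by (simp add: sum_subtractf n_def)
  also have "\<dots> \<le> (\<Sum>v\<in>V. real (card (N v) choose r))"
    using r by (intro sum_mono power_div_le_binomial_plus_one)
  also have "\<dots> = real (\<Sum>v\<in>V. card {R \<in> P. R \<subseteq> N v})"
    by (simp add: choose)
  also have "(\<Sum>v\<in>V. card {R \<in> P. R \<subseteq> N v}) = (\<Sum>R\<in>P. card {v \<in> V. R \<subseteq> N v})"
    using fin finP by (intro sum_multicount_gen) auto
  also have "real (\<Sum>R\<in>P. card {v \<in> V. R \<subseteq> N v}) \<le> real (\<Sum>R\<in>P. q)"
    using neg by (intro of_nat_mono sum_mono) (auto simp: P_def not_le less_imp_le)
  also have "\<dots> = real q * real (n choose r)"
    using fin by (simp add: P_def n_subsets n_def)
  also have "\<dots> \<le> real q * real n ^ r"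
    using binomial_le_pow[of r n] by (cases "r \<le> n") (simp_all add: mult_left_mono binomial_eq_0 flip: of_nat_power)
  finally have "2 * real n ^ r \<le> real n" using low by (simp add: algebra_simps)
  moreover have "real n \<le> real n ^ r" using n_pos r by (intro self_le_power) auto
  ultimately show False using n_pos by simp
qed

section \<open>Transitive sets as sorted lists\<close>

text \<open>For \<open>k \<ge> 2\<close>, a vertex splits the remaining at least \<open>2 ^ (k - 1) - 1\<close> vertices into out- and in-neighbours,
  one of which has at least \<open>2 ^ (k - 2)\<close> elements; the vertex goes in front of or behind
  a list found there.\<close>

lemma exists_transitive_list:
  assumes "finite A" "total_on A E" "2 ^ (k - 1) \<le> card A"
  shows "\<exists>xs. length xs = k \<and> distinct xs \<and> set xs \<subseteq> A \<and> sorted_wrt (\<lambda>u v. (u, v) \<in> E) xs"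
  using assms
proof (induction k arbitrary: A)
  case (Suc k)
  have "A \<noteq> {}" using Suc.prems by auto
  then obtain a where a: "a \<in> A" by auto
  show ?case
  proof (cases k)
    case 0
    then show ?thesis using a by (intro exI[of _ "[a]"]) auto
  next
    case (Suc k')
    define Out In where "Out = {v \<in> A - {a}. (a, v) \<in> E}" and "In = {v \<in> A - {a}. (a, v) \<notin> E}"
    have fin: "finite Out" "finite In" using Suc.prems by (auto simp: Out_def In_def)
    have tot: "total_on Out E" "total_on In E"
      using Suc.prems(2) by (auto simp: total_on_def Out_def In_def)
    have "A = insert a (Out \<union> In)" "a \<notin> Out \<union> In" "Out \<inter> In = {}" using a by (auto simp: Out_def In_def)
    then have "card A = Suc (card Out + card In)"
      using fin by (simp add: card_Un_disjoint)
    moreover have "2 * 2 ^ (k - 1) \<le> card A" using Suc.prems(3) Suc by simp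
    ultimately consider "2 ^ (k - 1) \<le> card Out" | "2 ^ (k - 1) \<le> card In" by linarith
    then show ?thesis
    proof cases
      case 1
      from Suc.IH[OF fin(1) tot(1) 1] obtain xs where "length xs = k" "distinct xs" "set xs \<subseteq> Out"
        "sorted_wrt (\<lambda>u v. (u, v) \<in> E) xs" by blast
      then show ?thesis using a by (intro exI[of _ "a # xs"]) (auto simp: Out_def)
    next
      case 2
      from Suc.IH[OF fin(2) tot(2) 2] obtain xs where xs: "length xs = k" "distinct xs" "set xs \<subseteq> In"
        "sorted_wrt (\<lambda>u v. (u, v) \<in> E) xs" by blast
      moreover have "(v, a) \<in> E" if "v \<in> In" for v
        using that Suc.prems(2) a by (auto simp: In_def total_on_def)
      ultimately show ?thesis using a 
        by (intro exI[of _ "xs @ [a]"]) (auto simp: In_def sorted_wrt_append)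
    qed
  qed
qed auto

text \<open>Quicksort: choose a pivot \<open>a\<close> and sort its in- and out-neighbours. Transitivity through \<open>a\<close> gives
  all edges from the former to the latter.\<close>

lemma transitive_list_of_trans:
  assumes "finite A" "total_on A E"
    and "\<And>u v w. \<lbrakk>u \<in> A; v \<in> A; w \<in> A; (u, v) \<in> E; (v, w) \<in> E\<rbrakk> \<Longrightarrow> (u, w) \<in> E"
  shows "\<exists>xs. distinct xs \<and> set xs = A \<and> sorted_wrt (\<lambda>u v. (u, v) \<in> E) xs"
  using assms
proof (induction A rule: finite_psubset_induct)
  case (psubset A)
  show ?case
  proof (cases "A = {}")
    case False
    then obtain a where a: "a \<in> A" by auto
    define Out In where "Out = {v \<in> A - {a}. (a, v) \<in> E}" and "In = {v \<in> A - {a}. (a, v) \<notin> E}"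
    have psub: "Out \<subset> A" "In \<subset> A" using a by (auto simp: Out_def In_def)
    have tot: "total_on Out E" "total_on In E"
      using psubset.prems(1) by (auto simp: total_on_def Out_def In_def)
    obtain xs where xs: "distinct xs" "set xs = Out" "sorted_wrt (\<lambda>u v. (u, v) \<in> E) xs"
      using psubset.IH[OF psub(1) tot(1)] psubset.prems(2) psub(1) by blast
    obtain ys where ys: "distinct ys" "set ys = In" "sorted_wrt (\<lambda>u v. (u, v) \<in> E) ys"
      using psubset.IH[OF psub(2) tot(2)] psubset.prems(2) psub(2) by blast
    have In: "(v, a) \<in> E" if "v \<in> In" for v
      using that psubset.prems(1) a by (auto simp: In_def total_on_def)
    have cross: "(v, w) \<in> E" if "v \<in> In" "w \<in> Out" for v w
      using psubset.prems(2)[OF _ _ _ In[OF that(1)], of w] that a by (auto simp: Out_def In_def)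
    have "sorted_wrt (\<lambda>u v. (u, v) \<in> E) (ys @ a # xs)"
      unfolding sorted_wrt_append using xs ys In cross by (simp add: Out_def)
    moreover have "distinct (ys @ a # xs)" "set (ys @ a # xs) = A"
      using xs(1,2) ys(1,2) a by (auto simp: Out_def In_def)
    ultimately show ?thesis by blast
  qed auto
qed

context tournament begin

lemma total_on_parcs: "S \<subseteq> pverts T \<Longrightarrow> total_on S (parcs T)"
  using exactly_one by (auto simp: total_on_def)

lemma parcs_asym: "(u, v) \<in> parcs T \<Longrightarrow> (v, u) \<notin> parcs T"
  using exactly_one[of u v] pair_no_loops[of "(u, v)"] in_arcsD1 in_arcsD2 by auto

text \<open>The edge relation is transitive on \<open>S\<close>, since otherwise an edge \<open>(w, u)\<close> would close the path
  \<open>u, v, w\<close> to a cycle.\<close>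

lemma transitive_set_imp_list:
  assumes "transitive_set T S"
  shows "\<exists>xs. distinct xs \<and> set xs = S \<and> sorted_wrt (\<lambda>u v. (u, v) \<in> parcs T) xs"
proof (rule transitive_list_of_trans)
  have S: "S \<subseteq> pverts T" using assms by (simp add: transitive_set_def)
  then show "finite S" "total_on S (parcs T)"
    using finite_subset[OF _ pair_finite_verts] total_on_parcs by auto
  fix u v w assume uvw: "u \<in> S" "v \<in> S" "w \<in> S" "(u, v) \<in> parcs T" "(v, w) \<in> parcs T"
  show "(u, w) \<in> parcs T"
  proof (rule ccontr)
    assume "(u, w) \<notin> parcs T"
    moreover have "u \<noteq> w" using uvw parcs_asym by auto
    ultimately have wu: "(w, u) \<in> parcs T" using uvw S exactly_one[of u w] by auto
    have "u \<noteq> v" "v \<noteq> w" using uvw pair_no_loops by force+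
    let ?G = "with_proj T \<restriction> S"
    have "pre_digraph.cycle ?G [(u, v), (v, w), (w, u)]"
      unfolding pre_digraph.cycle_def pre_digraph.awalk_def
      using uvw wu \<open>u \<noteq> v\<close> \<open>v \<noteq> w\<close> \<open>u \<noteq> w\<close>
      by (auto simp: pre_digraph.cas.simps pre_digraph.awalk_verts.simps)
    then show False using assms by (auto simp: transitive_set_def)
  qed
qed

end

text \<open>The map matches equal positions. As \<open>E\<close> is asymmetric, its edges inside \<open>as\<close> go forward in the
  list, and every forward pair in \<open>xs\<close> is an edge of \<open>E'\<close>.\<close>

lemma order_embedding_of_lists:
  assumes as: "distinct as" "sorted_wrt (\<lambda>u v. (u, v) \<in> E) as"
    and asym: "\<And>u v. (u, v) \<in> E \<Longrightarrow> (v, u) \<notin> E"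
    and xs: "distinct xs" "sorted_wrt (\<lambda>u v. (u, v) \<in> E') xs"
    and len: "length as = length xs"
  shows "\<exists>f. bij_betw f (set as) (set xs) \<and>
           (\<forall>u\<in>set as. \<forall>v\<in>set as. (u, v) \<in> E \<longrightarrow> (f u, f v) \<in> E')"
proof -
  let ?I = "{..<length as}"
  define g where "g = inv_into ?I ((!) as)"
  have bij: "bij_betw ((!) as) ?I (set as)" using as(1) by (simp add: bij_betw_nth)
  have "bij_betw g (set as) ?I" unfolding g_def by (rule bij_betw_inv_into[OF bij])
  then have g: "g u < length as" "as ! g u = u" if "u \<in> set as" for u
    using that bij_betw_inv_into_right[OF bij] by (auto simp: g_def bij_betw_def)
  have "bij_betw ((!) xs \<circ> g) (set as) (set xs)"
    using bij_betw_trans[OF \<open>bij_betw g (set as) ?I\<close>] bij_betw_nth[OF xs(1) refl refl] len by simp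
  moreover have "(xs ! g u, xs ! g v) \<in> E'" if uv: "u \<in> set as" "v \<in> set as" "(u, v) \<in> E" for u v
  proof -
    have "\<not> g v < g u"
      using sorted_wrt_nth_less[OF as(2), of "g v" "g u"] g uv asym by auto
    moreover have "g u \<noteq> g v" using g(2) uv asym by metis
    ultimately show ?thesis
      using sorted_wrt_nth_less[OF xs(2), of "g u" "g v"] g uv len by auto
  qed
  ultimately show ?thesis by (intro exI[of _ "(!) xs \<circ> g"]) auto
qed

section \<open>Copies of the tournament\<close>

lemma contains_copy_if_embedding:
  assumes "pair_wf_digraph D" "pair_wf_digraph H" "inj_on f (pverts H)" "f ` pverts H \<subseteq> pverts D"
    and arcs: "\<And>u v. (u, v) \<in> parcs H \<Longrightarrow> (f u, f v) \<in> parcs D"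
  shows "contains_copy D H"
proof -
  interpret H: pair_wf_digraph H by fact
  define hom where "hom = \<lparr>iso_verts = f, iso_arcs = map_prod f f, iso_head = snd, iso_tail = fst\<rparr>"
  have "parcs H \<subseteq> pverts H \<times> pverts H" using H.in_arcsD1 H.in_arcsD2 by auto
  then have "inj_on (map_prod f f) (parcs H)"
    by (rule inj_on_subset[OF map_prod_inj_on[OF assms(3,3)]])
  then have iso: "pre_digraph.digraph_isomorphism (with_proj H) hom"
    unfolding pre_digraph.digraph_isomorphism_def
    using assms(3) H.wf_digraph_axioms by (simp add: hom_def)
  let ?K = "app_iso hom (with_proj H)"
  have wfD: "wf_digraph (with_proj D)" using assms(1) by (simp add: wf_digraph_wp_iff)
  have "digraph_iso (with_proj H) ?K" using iso unfolding digraph_iso_def by blast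
  then have "digraph_iso ?K (with_proj H)"
    using H.wf_digraph_axioms by (rule digraph_iso_swap[rotated])
  moreover have "wf_digraph ?K"
    by unfold_locales (auto simp: hom_def dest: H.in_arcsD1 H.in_arcsD2)
  then have "subgraph ?K (with_proj D)"
    using assms(4) arcs wfD by (auto simp: subgraph_def compatible_def hom_def)
  ultimately show ?thesis unfolding contains_copy_def by blast
qed

text \<open>The classes of \<open>H\<close> are embedded separately. An edge of \<open>H\<close> between them may have either
  direction, but its image is a pair of \<open>F\<close>, where both directions are present.\<close>

lemma contains_copy_of_joined_lists:
  assumes T: "tournament T" and H: "tournament H" and F: "F \<subseteq> parcs T"
    and as: "distinct as" "sorted_wrt (\<lambda>u v. (u, v) \<in> parcs H) as"
    and bs: "distinct bs" "sorted_wrt (\<lambda>u v. (u, v) \<in> parcs H) bs"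
    and H_parts: "set as \<union> set bs = pverts H" "set as \<inter> set bs = {}"
    and xs: "distinct xs" "sorted_wrt (\<lambda>u v. (u, v) \<in> parcs T) xs" "length as = length xs"
    and ys: "distinct ys" "sorted_wrt (\<lambda>u v. (u, v) \<in> parcs T) ys" "length bs = length ys"
    and T_parts: "set xs \<subseteq> pverts T" "set ys \<subseteq> pverts T"
    and joined: "set ys \<times> set xs \<subseteq> F"
  shows "contains_copy (add_reversed T F) H"
proof -
  interpret T: tournament T by fact
  interpret H: tournament H by fact
  obtain f where f: "bij_betw f (set as) (set xs)"
    "\<And>u v. \<lbrakk>u \<in> set as; v \<in> set as; (u, v) \<in> parcs H\<rbrakk> \<Longrightarrow> (f u, f v) \<in> parcs T"
    using order_embedding_of_lists[OF as H.parcs_asym xs] by blast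
  obtain g where g: "bij_betw g (set bs) (set ys)"
    "\<And>u v. \<lbrakk>u \<in> set bs; v \<in> set bs; (u, v) \<in> parcs H\<rbrakk> \<Longrightarrow> (g u, g v) \<in> parcs T"
    using order_embedding_of_lists[OF bs H.parcs_asym ys] by blast
  define h where "h u = (if u \<in> set as then f u else g u)" for u
  \<comment> \<open>a common vertex would give a loop in \<open>F\<close>\<close>
  have disj: "set xs \<inter> set ys = {}"
    using joined F T.pair_no_loops by fastforce
  have cross: "(y, x) \<in> parcs T \<union> F\<inverse>" "(x, y) \<in> parcs T \<union> F\<inverse>" if "x \<in> set xs" "y \<in> set ys" for x y
    using that joined F by auto
  have hf: "h u = f u" "f u \<in> set xs" if "u \<in> set as" for u
    using that f(1) by (auto simp: h_def bij_betw_def)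
  have hg: "h u = g u" "g u \<in> set ys" if "u \<in> set bs" for u
    using that g(1) H_parts(2) by (auto simp: h_def bij_betw_def)
  have bij: "bij_betw h (pverts H) (set xs \<union> set ys)"
    unfolding H_parts(1)[symmetric]
  proof (rule bij_betw_combine[OF _ _ disj])
    show "bij_betw h (set as) (set xs)" using f(1) hf(1) bij_betw_cong[of "set as" h f] by simp
    show "bij_betw h (set bs) (set ys)" using g(1) hg(1) bij_betw_cong[of "set bs" h g] by simp
  qed
  show ?thesis
  proof (rule contains_copy_if_embedding)
    show "pair_wf_digraph (add_reversed T F)"
      using F T.in_arcsD1 T.in_arcsD2 by unfold_locales (auto simp: add_reversed_def)
    show "pair_wf_digraph H" by unfold_locales
    show "inj_on h (pverts H)" "h ` pverts H \<subseteq> pverts (add_reversed T F)"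
      using bij T_parts by (auto simp: bij_betw_def add_reversed_def)
    fix u v assume uv: "(u, v) \<in> parcs H"
    then have "u \<in> set as \<union> set bs" "v \<in> set as \<union> set bs"
      using H.in_arcsD1 H.in_arcsD2 H_parts(1) by auto
    then show "(h u, h v) \<in> parcs (add_reversed T F)"
      using uv f(2)[of u v] g(2)[of u v] hf[of u] hf[of v] hg[of u] hg[of v]
        cross[of "h u" "h v"] cross[of "h v" "h u"]
      by (auto simp: add_reversed_def)
  qed
qed

section \<open>Bounds on the number of added edges\<close>

lemma turan_add_le:
  fixes H :: "'b pair_pre_digraph"
  assumes "\<And>(T :: nat pair_pre_digraph) F. \<lbrakk>tournament T; card (pverts T) = n; F \<subseteq> parcs T; card F = t\<rbrakk>
    \<Longrightarrow> contains_copy (add_reversed T F) H"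
  shows "turan_add n H \<le> t"
  unfolding turan_add_def using assms by (intro Least_le) blast

lemma turan_add_bound:
  fixes H :: "'b pair_pre_digraph"
  assumes H: "tournament H"
    and as: "distinct as" "sorted_wrt (\<lambda>u v. (u, v) \<in> parcs H) as"
    and bs: "distinct bs" "sorted_wrt (\<lambda>u v. (u, v) \<in> parcs H) bs"
    and H_parts: "set as \<union> set bs = pverts H" "set as \<inter> set bs = {}"
    and n: "0 < n"
  defines "r \<equiv> 2 ^ (length as - 1)" and "q \<equiv> 2 ^ (length bs - 1)"
  assumes t: "real (r * (q + 2)) * real n powr (2 - 1 / real r) \<le> real t"
  shows "turan_add n H \<le> t"
proof (rule turan_add_le)
  fix T :: "nat pair_pre_digraph" and F
  assume T: "tournament T" and card: "card (pverts T) = n" "card F = t" and F: "F \<subseteq> parcs T"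
  interpret T: tournament T by fact
  define N where "N v = F `` {v}" for v
  have NV: "N v \<subseteq> pverts T" for v using F T.in_arcsD2 by (auto simp: N_def)
  have "F = Sigma (pverts T) N" using F T.in_arcsD1 by (auto simp: N_def)
  then have "t = (\<Sum>v\<in>pverts T. card (N v))"
    using card T.pair_finite_verts finite_subset[OF NV] by simp
  then have "real (r * (q + 2)) * real (card (pverts T)) powr (2 - 1 / real r)
      \<le> real (\<Sum>v\<in>pverts T. card (N v))"
    using t card by simp
  moreover have "0 < card (pverts T)" "0 < r" using n card by (simp_all add: r_def)
  ultimately obtain R where R: "R \<subseteq> pverts T" "card R = r" "q \<le> card {v \<in> pverts T. R \<subseteq> N v}"
    using common_neighbours_of_some_subset[where N = N, OF T.pair_finite_verts NV, of r q] by auto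
  define S where "S = {v \<in> pverts T. R \<subseteq> N v}"
  have S: "S \<subseteq> pverts T" by (auto simp: S_def)
  obtain xs where xs: "length xs = length as" "distinct xs" "set xs \<subseteq> R"
    "sorted_wrt (\<lambda>u v. (u, v) \<in> parcs T) xs"
    using exists_transitive_list[OF finite_subset[OF R(1) T.pair_finite_verts] T.total_on_parcs[OF R(1)],
        of "length as"] R(2) by (auto simp: r_def)
  obtain ys where ys: "length ys = length bs" "distinct ys" "set ys \<subseteq> S"
    "sorted_wrt (\<lambda>u v. (u, v) \<in> parcs T) ys"
    using exists_transitive_list[OF finite_subset[OF S T.pair_finite_verts] T.total_on_parcs[OF S],
        of "length bs"] R(3) by (auto simp: q_def S_def)
  have "set ys \<times> set xs \<subseteq> F" using xs(3) ys(3) by (auto simp: S_def N_def)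
  then show "contains_copy (add_reversed T F) H"
    using contains_copy_of_joined_lists[OF T H F as(1,2) bs H_parts, of xs ys] xs ys R(1) S by auto
qed

lemma turan_add_transitive_eq_0:
  fixes H :: "'b pair_pre_digraph"
  assumes H: "tournament H"
    and bs: "distinct bs" "sorted_wrt (\<lambda>u v. (u, v) \<in> parcs H) bs" "set bs = pverts H"
    and n: "2 ^ (length bs - 1) \<le> n"
  shows "turan_add n H = 0"
proof -
  have "turan_add n H \<le> 0"
  proof (rule turan_add_le)
    fix T :: "nat pair_pre_digraph" and F
    assume T: "tournament T" and card: "card (pverts T) = n" and F: "F \<subseteq> parcs T"
    interpret T: tournament T by fact
    obtain ys where "length ys = length bs" "distinct ys" "set ys \<subseteq> pverts T"
      "sorted_wrt (\<lambda>u v. (u, v) \<in> parcs T) ys"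
      using exists_transitive_list[OF T.pair_finite_verts T.total_on_parcs[OF subset_refl],
          of "length bs"] n card by auto
    then show "contains_copy (add_reversed T F) H"
      using contains_copy_of_joined_lists[OF T H F, of "[]" bs "[]" ys] bs by auto
  qed
  then show ?thesis by simp
qed

section \<open>Two-colourings\<close>

lemma transitive_set_if_no_arcs:
  assumes "S \<subseteq> pverts T" "\<And>u v. \<lbrakk>u \<in> S; v \<in> S\<rbrakk> \<Longrightarrow> (u, v) \<notin> parcs T"
  shows "transitive_set T S"
proof -
  have "arcs (with_proj T \<restriction> S) = {}" using assms(2) by auto
  then show ?thesis
    using assms(1)
    by (simp add: transitive_set_def pre_digraph.cycle_def pre_digraph.awalk_def del: induce_subgraph_arcs)
qed

text \<open>The classes are singletons. One further, empty class makes their number positive even if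
  there are no vertices.\<close>

lemma (in tournament) coloring_exists: "\<exists>k>0. \<exists>C. coloring T k C"
proof -
  obtain f where f: "bij_betw f {..<card (pverts T)} (pverts T)"
    using ex_bij_betw_nat_finite[OF pair_finite_verts] by (auto simp: atLeast0LessThan)
  let ?m = "card (pverts T)"
  define C where "C i = (if i < ?m then {f i} else {})" for i
  have "disjoint_family_on C {..<Suc ?m}"
    using f by (auto simp: disjoint_family_on_def C_def bij_betw_def inj_on_def)
  moreover have "(\<Union>i<Suc ?m. C i) = pverts T"
    using f by (auto simp: C_def bij_betw_def lessThan_Suc split: if_splits)
  moreover have "transitive_set T (C i)" for i
    using f pair_no_loops by (intro transitive_set_if_no_arcs) (force simp: C_def bij_betw_def split: if_splits)+
  ultimately show ?thesis unfolding coloring_def by blast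
qed

text \<open>A 1-colouring becomes a 2-colouring by adding an empty class.\<close>

lemma coloring_two_of_chromatic_number_le_2:
  assumes "tournament H" "chromatic_number H \<le> 2"
  shows "\<exists>C. coloring H 2 C"
proof -
  let ?k = "chromatic_number H"
  have "0 < ?k \<and> (\<exists>C. coloring H ?k C)"
    unfolding chromatic_number_def
    using LeastI_ex[of "\<lambda>k. 0 < k \<and> (\<exists>C. coloring H k C)"] tournament.coloring_exists[OF assms(1)]
    by blast
  then obtain C where k: "0 < ?k" and C: "coloring H ?k C" by blast
  show ?thesis
  proof (cases "?k = 2")
    case False
    then have "?k = 1" using k assms(2) by linarith
    then have C0: "C 0 = pverts H" "transitive_set H (C 0)"
      using C by (auto simp: coloring_def)
    have "transitive_set H {}" by (rule transitive_set_if_no_arcs) auto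
    then have "coloring H 2 (\<lambda>i. if i = 0 then C 0 else {})"
      using C0 by (auto simp: coloring_def disjoint_family_on_def split: if_splits)
    then show ?thesis by blast
  qed (use C in auto)
qed

lemma coloring_of_min_class_size:
  assumes "tournament H" "chromatic_number H \<le> 2"
  obtains A B where "transitive_set H A" "transitive_set H B" "A \<union> B = pverts H" "A \<inter> B = {}"
    "card A = min_class_size H"
proof -
  have "\<exists>s C. coloring H 2 C \<and> (\<exists>i<2. card (C i) = s)"
    using coloring_two_of_chromatic_number_le_2[OF assms] zero_less_numeral by blast
  then have "\<exists>C. coloring H 2 C \<and> (\<exists>i<2. card (C i) = min_class_size H)"
    unfolding min_class_size_def by (rule LeastI_ex[of "\<lambda>s. \<exists>C. coloring H 2 C \<and> (\<exists>i<2. card (C i) = s)"])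
  then obtain C i where C: "coloring H 2 C" and i: "i < 2" "card (C i) = min_class_size H" by blast
  have two: "{..<2} = {i, 1 - i}" "i \<noteq> 1 - i" "1 - i < 2"
    using i(1) by (auto simp: less_2_cases_iff)
  show thesis
  proof (rule that)
    show "transitive_set H (C i)" "transitive_set H (C (1 - i))" 
      using C i(1) two(3) by (auto simp: coloring_def)
    show "C i \<union> C (1 - i) = pverts H" using C two(1) by (auto simp: coloring_def)
    show "C i \<inter> C (1 - i) = {}" 
      using C two i(1) by (auto simp: coloring_def disjoint_family_on_def)
  qed (fact i(2))
qed

theorem proposition1p2:
  fixes H :: "'a pair_pre_digraph"
  assumes "tournament H"
    and "chromatic_number H \<le> 2"
  shows "(\<lambda>n. real (turan_add n H))
           \<in> O(\<lambda>n. real n powr (2 - 1 / 2 powr (real (min_class_size H) - 1)))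
         \<and> (min_class_size H = 1 \<longrightarrow> (\<lambda>n. real (turan_add n H)) \<in> O(\<lambda>n. real n))"
proof -
  interpret tournament H by fact
  define s where "s = min_class_size H"
  obtain A B where AB: "transitive_set H A" "transitive_set H B" "A \<union> B = pverts H" "A \<inter> B = {}"
    and s: "card A = s"
    using coloring_of_min_class_size[OF assms] unfolding s_def by blast
  obtain as where as: "distinct as" "set as = A" "sorted_wrt (\<lambda>u v. (u, v) \<in> parcs H) as"
    using transitive_set_imp_list[OF AB(1)] by blast
  obtain bs where bs: "distinct bs" "set bs = B" "sorted_wrt (\<lambda>u v. (u, v) \<in> parcs H) bs"
    using transitive_set_imp_list[OF AB(2)] by blast
  have len: "length as = s" using distinct_card[OF as(1)] as(2) s by simp
  define e where "e = 2 - 1 / 2 powr (real s - 1)"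
  have main: "(\<lambda>n. real (turan_add n H)) \<in> O(\<lambda>n. real n powr e)"
  proof (cases "s = 0")
    case True
    have "eventually (\<lambda>n. turan_add n H = 0) at_top"
      using eventually_ge_at_top[of "2 ^ (length bs - 1)"]
      by eventually_elim
        (use turan_add_transitive_eq_0[OF assms(1) bs(1,3)] as bs AB len True in auto)
    then show ?thesis by (intro bigoI[of _ 0]) (auto elim: eventually_mono)
  next
    case False
    define r q :: nat where "r = 2 ^ (length as - 1)" and "q = 2 ^ (length bs - 1)"
    define c where "c = real (r * (q + 2))"
    have "real r = 2 powr (real s - 1)"
      using False by (simp add: r_def len of_nat_diff flip: powr_realpow)
    then have e: "e = 2 - 1 / real r" by (simp add: e_def)
    have "1 \<le> real r" by (simp add: r_def)
    then have e_nonneg: "0 \<le> e" by (simp add: e field_simps)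
    \<comment> \<open>rounding up costs at most 1, which is absorbed since \<open>e\<close> is nonnegative\<close>
    have "real (turan_add n H) \<le> (c + 1) * n powr e" if n: "1 \<le> n" for n
    proof -
      have "turan_add n H \<le> nat \<lceil>c * n powr e\<rceil>"
      proof (rule turan_add_bound[OF assms(1) as(1,3) bs(1,3)])
        show "real (2 ^ (length as - 1) * (2 ^ (length bs - 1) + 2)) *
            real n powr (2 - 1 / real (2 ^ (length as - 1))) \<le> real (nat \<lceil>c * n powr e\<rceil>)"
          using real_nat_ceiling_ge[of "c * n powr e"] unfolding e c_def r_def q_def by simp
      qed (use as bs AB n in auto)
      moreover have "real (nat \<lceil>c * n powr e\<rceil>) \<le> c * n powr e + 1"
        using of_int_ceiling_le_add_one[of "c * n powr e"] by (simp add: c_def)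
      ultimately have "real (turan_add n H) \<le> c * n powr e + 1" by linarith
      moreover have "1 \<le> real n powr e" using n e_nonneg by (simp add: ge_one_powr_ge_zero)
      ultimately show ?thesis by (simp add: algebra_simps)
    qed
    then show ?thesis
      by (intro bigoI[of _ "c + 1"] eventually_mono[OF eventually_ge_at_top[of 1]]) simp
  qed
  moreover have "(\<lambda>n. real (turan_add n H)) \<in> O(\<lambda>n. real n)" if "s = 1"
    using main that by (simp add: e_def)
  ultimately show ?thesis by (simp add: e_def s_def)
qed

end
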